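(* Let $f\colon \mathbb{R}^n_{>0}\to\mathbb{R}$ be a signomial. If at most one coefficient of $f$ is negative, then $f^{-1}(\mathbb{R}_{<0})$ is a logarithmically convex set, i.e. the set $\operatorname{Log}(f^{-1}(\mathbb{R}_{<0}))\subseteq\mathbb{R}^n$ is convex. In particular, $V_{>0}^c(f)$ has at most one negative connected component.
   Context: A signomial is a function $f\colon \mathbb{R}^n_{>0}\to\mathbb{R}$, $f(x)=\sum_{\mu\in\sigma(f)}c_\mu x^\mu$, where $\sigma(f)\subseteq\mathbb{R}^n$ is a finite set (real exponents allowed), $c_\mu\in\mathbb{R}\setminus\{0\}$ are its coefficients, and $x^\mu=x_1^{\mu_1}\cdots x_n^{\mu_n}$. $V_{>0}^c(f)=\{x\in\mathbb{R}^n_{>0}\mid f(x)\neq 0\}$; a connected component $U$ of $V_{>0}^c(f)$ is negative if $f(x)<0$ for all $x\in U$. $\operatorname{Log}\colon\mathbb{R}^n_{>0}\to\mathbb{R}^n$ is the coordinate-wise natural logarithm. *)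

theory Defs
  imports "HOL-Analysis.Analysis"
begin

definition pos_orthant :: "(real ^ 'n) set" where
  "pos_orthant = {x. \<forall>i. 0 < x $ i}"

definition monomial :: "real ^ 'n \<Rightarrow> real ^ 'n \<Rightarrow> real" where
  "monomial \<mu> x = (\<Prod>i\<in>UNIV. (x $ i) powr (\<mu> $ i))"

text \<open>
  \<open>signomial f S c\<close>: on the positive orthant, \<open>f\<close> is the signomial with support \<open>S\<close> and
  coefficients \<open>c \<mu>\<close> for \<open>\<mu> \<in> S\<close>. The domain of a signomial is the positive orthant, so the
  values of \<open>f\<close> elsewhere, like those of \<open>c\<close> outside \<open>S\<close>, are irrelevant. The support may be
  empty, in which case \<open>f\<close> is zero.
\<close>
definition signomial ::
  "(real ^ 'n \<Rightarrow> real) \<Rightarrow> (real ^ 'n) set \<Rightarrow> (real ^ 'n \<Rightarrow> real) \<Rightarrow> bool" where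
  "signomial f S c \<longleftrightarrow>
     finite S \<and> (\<forall>\<mu>\<in>S. c \<mu> \<noteq> 0) \<and>
     (\<forall>x\<in>pos_orthant. f x = (\<Sum>\<mu>\<in>S. c \<mu> * monomial \<mu> x))"

definition Log :: "real ^ 'n \<Rightarrow> real ^ 'n" where
  "Log x = (\<chi> i. ln (x $ i))"

definition log_convex :: "(real ^ 'n) set \<Rightarrow> bool" where
  "log_convex A \<longleftrightarrow> A \<subseteq> pos_orthant \<and> convex (Log ` A)"

definition nonvanishing_set :: "(real ^ 'n \<Rightarrow> real) \<Rightarrow> (real ^ 'n) set" where
  "nonvanishing_set f = {x \<in> pos_orthant. f x \<noteq> 0}"

definition negative_components :: "(real ^ 'n \<Rightarrow> real) \<Rightarrow> (real ^ 'n) set set" where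
  "negative_components f = {U \<in> components (nonvanishing_set f). \<forall>x\<in>U. f x < 0}"

end

(* In logarithmic coordinates y = Log x, a monomial becomes exp (\<mu> \<bullet> y). If \<nu> is the only exponent
   with a negative coefficient, dividing by exp (\<nu> \<bullet> y) turns f < 0 into g < - c \<nu>, where g is a
   nonnegative combination of exponentials of linear forms. So the negative locus is a sublevel set
   of a convex function. Its image under the coordinatewise exponential is connected, hence it is the
   only possible negative component. *)

theory Submission
  imports Defs
begin

definition Exp :: "real ^ 'n \<Rightarrow> real ^ 'n" where
  "Exp y = (\<chi> i. exp (y $ i))"

lemma Exp_in_pos_orthant: "Exp y \<in> pos_orthant"
  by (simp add: Exp_def pos_orthant_def)

lemma Log_Exp: "Log (Exp y) = y"
  by (simp add: Exp_def Log_def vec_eq_iff)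

lemma Exp_Log: "x \<in> pos_orthant \<Longrightarrow> Exp (Log x) = x"
  by (simp add: Exp_def Log_def pos_orthant_def vec_eq_iff)

lemma continuous_on_Exp: "continuous_on A Exp"
  unfolding Exp_def by (intro continuous_intros)

lemma monomial_Exp: "monomial \<mu> (Exp y) = exp (\<mu> \<bullet> y)"
  by (simp add: monomial_def Exp_def powr_def inner_vec_def exp_sum)

text \<open>\<open>Log\<close> and \<open>Exp\<close> are mutually inverse between the orthant and
  the whole space, so an image under \<open>Log\<close> is a preimage under
  \<open>Exp\<close>.\<close>

lemma Log_image_pos_orthant:
  "Log ` {x \<in> pos_orthant. P x} = {y. P (Exp y)}"
  by (force simp: Exp_Log Log_Exp Exp_in_pos_orthant image_iff intro: exI[of _ "Exp _"])

lemma convex_on_exp_inner: "convex_on UNIV (\<lambda>y. exp (a \<bullet> y))"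
proof (rule convex_onI)
  fix t :: real and x y :: 'a
  assume "0 < t" "t < 1"
  then show "exp (a \<bullet> ((1 - t) *\<^sub>R x + t *\<^sub>R y)) \<le> (1 - t) * exp (a \<bullet> x) + t * exp (a \<bullet> y)"
    using convex_onD[OF exp_convex, of t "a \<bullet> x" "a \<bullet> y"] by (simp add: inner_right_distrib)
qed simp

text \<open>The exponents form a family \<open>a\<close> so that the shifted exponents \<mu> - \<nu>
  are covered as well.\<close>

lemma convex_on_exp_sum:
  assumes "finite S" "\<And>\<mu>. \<mu> \<in> S \<Longrightarrow> 0 \<le> c \<mu>"
  shows "convex_on UNIV (\<lambda>y. \<Sum>\<mu>\<in>S. c \<mu> * exp (a \<mu> \<bullet> y))"
  using assms
proof (induction S rule: finite_induct)
  case empty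
  then show ?case by (simp add: convex_on_const)
next
  case (insert \<mu> S)
  then show ?case
    by (simp add: convex_on_add convex_on_cmul convex_on_exp_inner)
qed

lemma convex_exp_sum_neg:
  fixes S :: "'a::real_inner set"
  assumes "finite S" and "card {\<mu> \<in> S. c \<mu> < 0} \<le> 1"
  shows "convex {y. (\<Sum>\<mu>\<in>S. c \<mu> * exp (\<mu> \<bullet> y)) < 0}"
proof (cases "{\<mu> \<in> S. c \<mu> < 0} = {}")
  case True
  \<comment> \<open>With no negative coefficient there is no \<nu> to divide by, but the negative
    locus is empty.\<close>
  then have "0 \<le> (\<Sum>\<mu>\<in>S. c \<mu> * exp (\<mu> \<bullet> y))" for y
    by (intro sum_nonneg) force
  then have "{y. (\<Sum>\<mu>\<in>S. c \<mu> * exp (\<mu> \<bullet> y)) < 0} = {}"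
    by (auto simp: not_less)
  then show ?thesis by simp
next
  case False
  with assms have "card {\<mu> \<in> S. c \<mu> < 0} = 1"
    by (simp add: card_gt_0_iff Suc_leI le_antisym)
  then obtain \<nu> where \<nu>: "{\<mu> \<in> S. c \<mu> < 0} = {\<nu>}"
    by (auto simp: card_1_singleton_iff)
  \<comment> \<open>The sum divided by \<open>exp (\<nu> \<bullet> y)\<close>, without its
    \<nu>-term, which has become the constant \<open>c \<nu>\<close>.\<close>
  define g where "g = (\<lambda>y. \<Sum>\<mu>\<in>S - {\<nu>}. c \<mu> * exp ((\<mu> - \<nu>) \<bullet> y))"
  have "\<nu> \<in> S" using \<nu> by blast
  have "0 \<le> c \<mu>" if "\<mu> \<in> S - {\<nu>}" for \<mu>
    using \<nu> that by force
  then have "convex_on UNIV g"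
    unfolding g_def using assms(1) by (intro convex_on_exp_sum) auto
  then have "convex {y. g y < - c \<nu>}"
    \<comment> \<open>On a segment, a convex function is at most the larger of its endpoint values,
      so the strict bound persists.\<close>
    by (auto simp: convex_def intro: le_less_trans[OF convex_lower])
  moreover have "(\<Sum>\<mu>\<in>S. c \<mu> * exp (\<mu> \<bullet> y)) < 0 \<longleftrightarrow> g y < - c \<nu>" for y
  proof -
    have "(\<Sum>\<mu>\<in>S. c \<mu> * exp (\<mu> \<bullet> y)) = (c \<nu> + g y) * exp (\<nu> \<bullet> y)"
      using assms(1) \<open>\<nu> \<in> S\<close>
      by (simp add: g_def sum.remove distrib_right sum_distrib_right mult.assoc
          inner_diff_left flip: exp_add)
    then show ?thesis
      by (auto simp: mult_less_0_iff)
  qed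
  ultimately show ?thesis by simp
qed

text \<open>A negative component is nonempty and lies in the negative locus; that locus is connected
  and avoids the zeros of \<open>f\<close>, so maximality of the component forces equality.\<close>

lemma negative_components_subset:
  assumes "connected {x \<in> pos_orthant. f x < 0}"
  shows "negative_components f \<subseteq> {{x \<in> pos_orthant. f x < 0}}"
proof
  let ?N = "{x \<in> pos_orthant. f x < 0}"
  fix U assume "U \<in> negative_components f"
  then have U: "U \<in> components (nonvanishing_set f)" and neg: "\<forall>x\<in>U. f x < 0"
    by (auto simp: negative_components_def)
  have "U \<subseteq> ?N"
    using in_components_subset[OF U] neg by (auto simp: nonvanishing_set_def)
  moreover from this have "?N \<subseteq> U"
    using in_components_nonempty[OF U] assms
    by (intro components_maximal[OF U]) (auto simp: nonvanishing_set_def)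
  ultimately show "U \<in> {?N}" by simp
qed

theorem theorem3p4:
  fixes f :: "real ^ 'n \<Rightarrow> real"
    and S :: "(real ^ 'n) set"
    and c :: "real ^ 'n \<Rightarrow> real"
  assumes "signomial f S c"
    and "card {\<mu> \<in> S. c \<mu> < 0} \<le> 1"
  shows "log_convex {x \<in> pos_orthant. f x < 0} \<and>
         finite (negative_components f) \<and> card (negative_components f) \<le> 1"
proof -
  let ?N = "{x \<in> pos_orthant. f x < 0}"
  have "Log ` ?N = {y. (\<Sum>\<mu>\<in>S. c \<mu> * exp (\<mu> \<bullet> y)) < 0}"
    using assms(1)
    by (simp add: Log_image_pos_orthant signomial_def Exp_in_pos_orthant monomial_Exp)
  then have convex: "convex (Log ` ?N)"
    using assms by (simp add: convex_exp_sum_neg signomial_def)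
  have "Exp ` Log ` ?N = ?N"
    by (force simp: image_image Exp_Log)
  then have "connected ?N"
    using connected_continuous_image[OF continuous_on_Exp convex_connected[OF convex]] by simp
  note sub = negative_components_subset[OF this]
  show ?thesis
    \<comment> \<open>Finiteness gives the cardinality bound its meaning, since \<open>card\<close>
      is 0 on infinite sets.\<close>
    using convex finite_subset[OF sub] card_mono[OF _ sub] by (auto simp: log_convex_def)
qed

end
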